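(* Let $G$ be a graph belonging to an association scheme $\mathcal{A}$ with $d$ classes, and suppose the discriminant $P$ of $G$ has $d+1$ distinct eigenvalues $\mu_0>\mu_1>\cdots>\mu_d$; let $E_j$ be the orthogonal projection onto the $\mu_j$-eigenspace of $P$ (these are the principal idempotents of $\mathcal{A}$). Let $u,v$ be distinct vertices and $\tau$ a positive integer. Then the Grover walk on $G$ exhibits perfect state transfer from $u$ to $v$ at time $\tau$ if and only if both of the following hold: (i) $\mathcal{A}$ contains a class $B$ which is a permutation matrix of order $2$ with no fixed points and satisfies $B_{uv}=1$; (ii) $T_\tau(\mu_j)=1$ for each $j\in\mathcal{I}_B^+$ and $T_\tau(\mu_j)=-1$ for each $j\in\mathcal{I}_B^-$.
   Context: Grover walk: let $G$ be a finite simple graph without isolated vertices. Its symmetric arc set is $\mathcal{A}(G)=\{(u,v),(v,u):uv\in E(G)\}$; for $a=(u,v)$, $t(a)=v$, $a^{-1}=(v,u)$. Shift matrix $S_{ab}=\delta_{a,b^{-1}}$; boundary matrix $N\in\mathbb{C}^{V(G)\times\mathcal{A}(G)}$, $N_{ua}=\frac{1}{\sqrt{\deg u}}\delta_{u,t(a)}$; coin $K=2N^*N-I$; time evolution matrix $U=SK$; discriminant $P=NSN^*$. For a vertex $u$, $\Phi_u=N^*\mathbf{e}_u$. $G$ exhibits perfect state transfer from $u$ to $v\neq u$ at time $\tau\in\mathbb{N}$ if $U^\tau\Phi_u=\gamma\Phi_v$ for some unimodular $\gamma$. $T_m$ is the Chebyshev polynomial of the first kind: $T_0=1$, $T_1=x$,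 $T_m=2xT_{m-1}-T_{m-2}$. Association scheme with $d$ classes: a set $\mathcal{A}=\{A_0,\dots,A_d\}$ of $n\times n$ $(0,1)$-matrices with $A_0=I$, $\sum_iA_i=J$, each $A_i$ symmetric, each $A_iA_j$ a linear combination of $A_0,\dots,A_d$. A graph belongs to $\mathcal{A}$ if its adjacency matrix lies in $\mathbb{C}[\mathcal{A}]=\operatorname{span}\{A_0,\dots,A_d\}$. The principal idempotents $E_0,\dots,E_d$ form a basis of $\mathbb{C}[\mathcal{A}]$ of symmetric matrices with $E_iE_j=\delta_{ij}E_i$ and $\sum_jE_j=I$. If a class $B\in\mathcal{A}$ is a permutation matrix of a fixed-point-free involution, then $BE_j=\pm E_j$ for each $j$; define $\mathcal{I}_B^+=\{j: BE_j=E_j\}$ and $\mathcal{I}_B^-=\{j:BE_j=-E_j\}$. *)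

theory Defs
  imports "HOL-Analysis.Analysis"
begin

section \<open>Complex matrices\<close>

definition adjoint_matrix :: "complex^'n^'m \<Rightarrow> complex^'m^'n" where
  "adjoint_matrix M = (\<chi> i j. cnj (M $ j $ i))"

definition eigenspace :: "complex^'n^'n \<Rightarrow> complex \<Rightarrow> (complex^'n) set" where
  "eigenspace M c = {x. M *v x = c *s x}"

definition eigenvalues :: "complex^'n^'n \<Rightarrow> complex set" where
  "eigenvalues M = {c. \<exists>x. x \<noteq> 0 \<and> M *v x = c *s x}"

text \<open>Orthogonality is with respect to the Hermitian inner product; the library's
  inner product on this type is only its real part.\<close>

definition hermitian_inner :: "complex^'n \<Rightarrow> complex^'n \<Rightarrow> complex" where
  "hermitian_inner x y = (\<Sum>i\<in>UNIV. cnj (x $ i) * y $ i)"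

definition orthogonal_projection_onto ::
  "complex^'n^'n \<Rightarrow> (complex^'n) set \<Rightarrow> bool" where
  "orthogonal_projection_onto E W \<longleftrightarrow>
     (\<forall>x. E *v x \<in> W \<and> (\<forall>w\<in>W. hermitian_inner w (x - E *v x) = 0))"

definition fixed_point_free_involution_matrix :: "complex^'n^'n \<Rightarrow> bool" where
  "fixed_point_free_involution_matrix B \<longleftrightarrow>
     (\<exists>\<sigma>. (\<forall>x. \<sigma> (\<sigma> x) = x) \<and> (\<forall>x. \<sigma> x \<noteq> x) \<and>
          B = (\<chi> x y. if y = \<sigma> x then 1 else 0))"

fun chebyshev_T :: "nat \<Rightarrow> real \<Rightarrow> real" where
  "chebyshev_T 0 x = 1"
| "chebyshev_T (Suc 0) x = x"
| "chebyshev_T (Suc (Suc m)) x = 2 * x * chebyshev_T (Suc m) x - chebyshev_T m x"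

section \<open>Grover walks\<close>

text \<open>A finite simple graph is given by its adjacency relation; its vertex set is the
  whole (finite) type.\<close>

definition simple_graph :: "('v::finite \<Rightarrow> 'v \<Rightarrow> bool) \<Rightarrow> bool" where
  "simple_graph adj \<longleftrightarrow> symp adj \<and> irreflp adj"

definition no_isolated_vertices :: "('v::finite \<Rightarrow> 'v \<Rightarrow> bool) \<Rightarrow> bool" where
  "no_isolated_vertices adj \<longleftrightarrow> (\<forall>x. \<exists>y. adj x y)"

definition adjacency_matrix :: "('v::finite \<Rightarrow> 'v \<Rightarrow> bool) \<Rightarrow> complex^'v^'v" where
  "adjacency_matrix adj = (\<chi> x y. if adj x y then 1 else 0)"

definition degree :: "('v::finite \<Rightarrow> 'v \<Rightarrow> bool) \<Rightarrow> 'v \<Rightarrow> nat" where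
  "degree adj x = card {y. adj x y}"

definition arcs :: "('v::finite \<Rightarrow> 'v \<Rightarrow> bool) \<Rightarrow> ('v \<times> 'v) set" where
  "arcs adj = {(x, y). adj x y}"

text \<open>The arc set depends on the graph, so it cannot serve as an index type. Vectors and
  matrices over the arcs are therefore indexed by all pairs of vertices and padded with zeros:
  every entry having an index that is not an arc is 0, including in the identity matrix of
  the arc space. Sums, products and adjoints of padded matrices are again padded and agree with
  those of the unpadded ones.\<close>

definition arc_identity ::
  "('v::finite \<Rightarrow> 'v \<Rightarrow> bool) \<Rightarrow> complex^('v \<times> 'v)^('v \<times> 'v)" where
  "arc_identity adj = (\<chi> a b. if a \<in> arcs adj \<and> b \<in> arcs adj \<and> a = b then 1 else 0)"

definition shift_matrix ::
  "('v::finite \<Rightarrow> 'v \<Rightarrow> bool) \<Rightarrow> complex^('v \<times> 'v)^('v \<times> 'v)" where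
  "shift_matrix adj =
     (\<chi> a b. if a \<in> arcs adj \<and> b \<in> arcs adj \<and> a = prod.swap b then 1 else 0)"

definition boundary_matrix ::
  "('v::finite \<Rightarrow> 'v \<Rightarrow> bool) \<Rightarrow> complex^('v \<times> 'v)^'v" where
  "boundary_matrix adj =
     (\<chi> x a. if a \<in> arcs adj \<and> x = snd a
             then complex_of_real (1 / sqrt (real (degree adj x))) else 0)"

definition coin_matrix ::
  "('v::finite \<Rightarrow> 'v \<Rightarrow> bool) \<Rightarrow> complex^('v \<times> 'v)^('v \<times> 'v)" where
  "coin_matrix adj =
     2 *\<^sub>R (adjoint_matrix (boundary_matrix adj) ** boundary_matrix adj) - arc_identity adj"

definition time_evolution ::
  "('v::finite \<Rightarrow> 'v \<Rightarrow> bool) \<Rightarrow> complex^('v \<times> 'v)^('v \<times> 'v)" where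
  "time_evolution adj = shift_matrix adj ** coin_matrix adj"

definition discriminant :: "('v::finite \<Rightarrow> 'v \<Rightarrow> bool) \<Rightarrow> complex^'v^'v" where
  "discriminant adj =
     boundary_matrix adj ** shift_matrix adj ** adjoint_matrix (boundary_matrix adj)"

definition vertex_state ::
  "('v::finite \<Rightarrow> 'v \<Rightarrow> bool) \<Rightarrow> 'v \<Rightarrow> complex^('v \<times> 'v)" where
  "vertex_state adj x = adjoint_matrix (boundary_matrix adj) *v axis x 1"

definition perfect_state_transfer ::
  "('v::finite \<Rightarrow> 'v \<Rightarrow> bool) \<Rightarrow> 'v \<Rightarrow> 'v \<Rightarrow> nat \<Rightarrow> bool" where
  "perfect_state_transfer adj u v \<tau> \<longleftrightarrow>
     u \<noteq> v \<and>
     (\<exists>\<gamma>. norm \<gamma> = 1 \<and>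
       (((*v) (time_evolution adj)) ^^ \<tau>) (vertex_state adj u) = \<gamma> *s vertex_state adj v)"

section \<open>Association schemes\<close>

definition scheme_span :: "nat \<Rightarrow> (nat \<Rightarrow> complex^'v^'v) \<Rightarrow> (complex^'v^'v) set" where
  "scheme_span d A = {M. \<exists>c::nat \<Rightarrow> complex. M = (\<chi> x y. \<Sum>i\<le>d. c i * A i $ x $ y)}"

text \<open>Only the values \<open>A 0, \<dots>, A d\<close> of the family matter; injectivity makes them
  \<open>d + 1\<close> different matrices.\<close>

definition association_scheme :: "nat \<Rightarrow> (nat \<Rightarrow> complex^'v^'v) \<Rightarrow> bool" where
  "association_scheme d A \<longleftrightarrow>
     inj_on A {..d} \<and>
     (\<forall>i\<le>d. \<forall>x y. A i $ x $ y \<in> {0, 1}) \<and>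
     A 0 = mat 1 \<and>
     (\<Sum>i\<le>d. A i) = (\<chi> x y. 1) \<and>
     (\<forall>i\<le>d. transpose (A i) = A i) \<and>
     (\<forall>i\<le>d. \<forall>j\<le>d. A i ** A j \<in> scheme_span d A)"

definition graph_belongs_to_scheme ::
  "('v::finite \<Rightarrow> 'v \<Rightarrow> bool) \<Rightarrow> nat \<Rightarrow> (nat \<Rightarrow> complex^'v^'v) \<Rightarrow> bool" where
  "graph_belongs_to_scheme adj d A \<longleftrightarrow> adjacency_matrix adj \<in> scheme_span d A"

definition plus_indices ::
  "nat \<Rightarrow> (nat \<Rightarrow> complex^'v^'v) \<Rightarrow> complex^'v^'v \<Rightarrow> nat set" where
  "plus_indices d E B = {j. j \<le> d \<and> B ** E j = E j}"

definition minus_indices ::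
  "nat \<Rightarrow> (nat \<Rightarrow> complex^'v^'v) \<Rightarrow> complex^'v^'v \<Rightarrow> nat set" where
  "minus_indices d E B = {j. j \<le> d \<and> B ** E j = - E j}"

end

theory Submission
  imports Defs "HOL-Computational_Algebra.Polynomial"
begin

text \<open>Let \<open>P\<close> be the discriminant. The walk satisfies \<open>N U\<^sup>t N\<^sup>* = T\<^sub>t(P)\<close>, since both sides obey the
  Chebyshev recurrence; as \<open>U\<close> is an isometry, perfect state transfer at time \<open>\<tau>\<close> means that
  \<open>T\<^sub>\<tau>(P)\<close> maps \<open>e\<^sub>u\<close> to \<open>\<gamma> e\<^sub>v\<close>. The graph is regular, so \<open>P\<close> and \<open>T\<^sub>\<tau>(P)\<close> lie in the span of the
  scheme, and an element of the span with a column of this shape is \<open>\<gamma>\<close> times a class that is a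
  fixed-point-free involution; evaluation at the all-ones vector gives \<open>\<gamma> = 1\<close>. Conversely, having
  \<open>d + 1\<close> distinct eigenvalues, \<open>P\<close> generates the span, and a polynomial in \<open>P\<close> is determined by its
  values at the eigenvalues; condition (ii) says that \<open>T\<^sub>\<tau>(P)\<close> and \<open>B\<close> agree there.\<close>

section \<open>Polynomials in a matrix\<close>

lemma matrix_add_rdistrib: "(A + B) ** C = A ** C + B ** (C :: 'a::semiring_1^'n^'m)"
  by (simp add: matrix_matrix_mult_def vec_eq_iff algebra_simps sum.distrib)

lemma matrix_diff_distrib:
  fixes A B :: "'a::ring_1^'n^'m" and C D :: "'a^'k^'n"
  shows "(A - B) ** C = A ** C - B ** C" "A ** (C - D) = A ** C - A ** D"
  by (simp_all add: matrix_matrix_mult_def vec_eq_iff algebra_simps sum_subtractf)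

lemma matrix_scaleR:
  fixes A :: "'a::real_algebra_1^'n^'m" and C :: "'a^'k^'n"
  shows "(r *\<^sub>R A) ** C = r *\<^sub>R (A ** C)" "A ** (r *\<^sub>R C) = r *\<^sub>R (A ** C)"
  by (simp_all add: matrix_matrix_mult_def vec_eq_iff scaleR_sum_right)

lemma matrix_vector_mult_scaleR_right:
  fixes A :: "'a::real_algebra_1^'n^'m"
  shows "A *v (r *\<^sub>R x) = r *\<^sub>R (A *v x)"
  by (simp add: matrix_vector_mult_def vec_eq_iff scaleR_sum_right)

lemma scaleR_matrix_vector_mult:
  fixes A :: "'a::real_algebra_1^'n^'m"
  shows "(r *\<^sub>R A) *v x = r *\<^sub>R (A *v x)"
  by (simp add: matrix_vector_mult_def vec_eq_iff scaleR_sum_right)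

lemma matrix_vector_mult_axis_nth: "(M *v axis k 1) $ x = (M $ x $ k :: 'a::semiring_1)"
proof -
  have "(M *v axis k 1) $ x = (\<Sum>j\<in>UNIV. if j = k then M $ x $ j else 0)"
    by (simp only: matrix_vector_mult_def axis_def vec_lambda_beta, rule sum.cong) auto
  then show ?thesis by simp
qed

lemma mat_mult_nth: "(mat c ** M) $ x $ y = (c :: 'a::semiring_1) * M $ x $ y"
proof -
  have "(mat c ** M) $ x $ y = (\<Sum>k\<in>UNIV. if k = x then c * M $ k $ y else 0)"
    by (simp only: matrix_matrix_mult_def mat_def vec_lambda_beta, rule sum.cong) auto
  then show ?thesis by simp
qed

lemma mat_mult_commute: "M ** mat c = mat c ** (M :: 'a::comm_semiring_1^'n^'n)"
proof -
  have "(M ** mat c) $ x $ y = (\<Sum>k\<in>UNIV. if k = y then M $ x $ k * c else 0)" for x y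
    by (simp only: matrix_matrix_mult_def mat_def vec_lambda_beta, rule sum.cong) auto
  then show ?thesis by (simp add: vec_eq_iff mat_mult_nth mult.commute)
qed

lemma mat_add: "mat (a + b) = mat a + (mat b :: 'a::semiring_1^'n^'n)"
  by (simp add: mat_def vec_eq_iff)

lemma mat_zero: "mat 0 = (0 :: 'a::semiring_1^'n^'n)"
  by (simp add: mat_def vec_eq_iff)

lemma mat_mult_mat: "mat a ** mat b = (mat (a * b) :: 'a::semiring_1^'n^'n)"
  unfolding vec_eq_iff by (auto simp: mat_mult_nth) (auto simp: mat_def)

lemma mat_mult_vector: "mat c *v x = c *s (x :: 'a::semiring_1^'n)"
proof -
  have "(mat c *v x) $ i = (\<Sum>k\<in>UNIV. if k = i then c * x $ k else 0)" for i
    by (simp only: matrix_vector_mult_def mat_def vec_lambda_beta, rule sum.cong) auto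
  then show ?thesis by (simp add: vec_eq_iff)
qed

text \<open>Complex scalars act through the scalar matrices \<open>mat c\<close>; this gives access
  to span, independence and dimension bounds over the complex numbers.\<close>

interpretation matrix_space: vector_space "\<lambda>c M. mat c ** (M :: complex^'n^'n)"
  by unfold_locales
    (simp_all add: matrix_add_ldistrib mat_add matrix_add_rdistrib matrix_mul_assoc mat_mult_mat)

text \<open>Horner evaluation with the matrix product \<open>**\<close>, since \<open>*\<close> on
  this type is entrywise.\<close>

definition matpoly :: "complex poly \<Rightarrow> complex^'n^'n \<Rightarrow> complex^'n^'n" where
  "matpoly p M = fold_coeffs (\<lambda>c X. mat c + M ** X) p 0"

lemma matpoly_0 [simp]: "matpoly 0 M = 0"
  by (simp add: matpoly_def)

lemma matpoly_pCons [simp]: "matpoly (pCons c p) M = mat c + M ** matpoly p M"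
  by (cases "p = 0 \<and> c = 0") (auto simp: matpoly_def mat_zero)

lemma matpoly_1 [simp]: "matpoly 1 M = mat 1"
  by (simp add: one_pCons)

lemma matpoly_add: "matpoly (p + q) M = matpoly p M + matpoly q M"
  by (induction p q rule: poly_induct2)
    (simp_all add: mat_add matrix_add_ldistrib add_ac)

lemma matpoly_smult: "matpoly (smult c p) M = mat c ** matpoly p M"
proof (induction p)
  case (pCons a p)
  have "M ** (mat c ** X) = mat c ** (M ** X)" for X :: "complex^'a^'a"
    by (simp only: matrix_mul_assoc mat_mult_commute)
  then show ?case using pCons by (simp add: matrix_add_ldistrib mat_mult_mat)
qed simp

lemma matpoly_diff: "matpoly (p - q) M = matpoly p M - matpoly q M"
  using matpoly_add[of "p - q" q M] by simp

lemma matpoly_mult: "matpoly (p * q) M = matpoly p M ** matpoly q M"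
  by (induction p)
    (simp_all add: matpoly_add matpoly_smult matrix_add_rdistrib matrix_mul_assoc mat_zero)

lemma matpoly_sum: "matpoly (\<Sum>i\<in>I. f i) M = (\<Sum>i\<in>I. matpoly (f i) M)"
  by (induction I rule: infinite_finite_induct) (simp_all add: matpoly_add)

text \<open>The bridge from polynomial identities in a matrix to scalar identities at its
  eigenvalues.\<close>

lemma matpoly_eigenvector:
  assumes "M *v x = c *s x"
  shows "matpoly p M *v x = poly p c *s x"
proof (induction p)
  case (pCons a p)
  have "(mat a + M ** matpoly p M) *v x = a *s x + M *v (matpoly p M *v x)"
    by (simp only: matrix_vector_mult_add_rdistrib mat_mult_vector matrix_vector_mul_assoc)
  also have "\<dots> = a *s x + poly p c *s (c *s x)"
    by (simp only: pCons.IH vector_scalar_commute assms)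
  finally show ?case
    by (simp add: vec_eq_iff algebra_simps)
qed simp

text \<open>The factor \<open>[:0, 2:]\<close> stands on the right, so that evaluation at
  \<open>P\<close> gives the previous polynomial applied to \<open>2 P x\<close>, the shape in which
  the walk produces it.\<close>

fun chebyshev_poly :: "nat \<Rightarrow> complex poly" where
  "chebyshev_poly 0 = 1"
| "chebyshev_poly (Suc 0) = [:0, 1:]"
| "chebyshev_poly (Suc (Suc m)) = chebyshev_poly (Suc m) * [:0, 2:] - chebyshev_poly m"

lemma poly_chebyshev_poly:
  "poly (chebyshev_poly m) (of_real x) = of_real (chebyshev_T m x)"
  by (induction m rule: chebyshev_poly.induct) simp_all

lemma chebyshev_T_1: "chebyshev_T m 1 = 1"
proof -
  \<comment> \<open>The recurrence has order two, so two consecutive values are carried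
    along.\<close>
  have "chebyshev_T m 1 = 1 \<and> chebyshev_T (Suc m) 1 = 1"
    by (induction m) auto
  then show ?thesis ..
qed

section \<open>The Hermitian inner product\<close>

lemma hermitian_inner_matrix_left:
  "hermitian_inner (M *v x) y = hermitian_inner x (adjoint_matrix M *v y)"
  unfolding hermitian_inner_def adjoint_matrix_def matrix_vector_mult_def
  by (simp add: sum_distrib_left sum_distrib_right, subst sum.swap)
    (simp add: mult_ac)

lemma adjoint_adjoint: "adjoint_matrix (adjoint_matrix M) = M"
  by (simp add: adjoint_matrix_def vec_eq_iff)

lemma adjoint_mult: "adjoint_matrix (M ** L) = adjoint_matrix L ** adjoint_matrix M"
  by (simp add: adjoint_matrix_def matrix_matrix_mult_def vec_eq_iff mult.commute)

lemma hermitian_inner_diff: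
  "hermitian_inner x (y - z) = hermitian_inner x y - hermitian_inner x z"
  "hermitian_inner (x - y) z = hermitian_inner x z - hermitian_inner y z"
  by (simp_all add: hermitian_inner_def algebra_simps sum_subtractf)

lemma hermitian_inner_commute: "hermitian_inner y x = cnj (hermitian_inner x y)"
  by (simp add: hermitian_inner_def mult.commute)

lemma hermitian_inner_self_eq_0: "hermitian_inner x x = 0 \<longleftrightarrow> x = 0"
proof
  assume "hermitian_inner x x = 0"
  then have "(\<Sum>i\<in>UNIV. complex_of_real ((cmod (x $ i))\<^sup>2)) = 0"
    by (simp only: hermitian_inner_def complex_norm_square mult.commute)
  then have "(\<Sum>i\<in>UNIV. (cmod (x $ i))\<^sup>2) = 0"
    by (simp only: of_real_sum[symmetric] of_real_eq_0_iff)
  then have "\<forall>i\<in>UNIV. (cmod (x $ i))\<^sup>2 = 0"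
    by (subst (asm) sum_nonneg_eq_0_iff) auto
  then show "x = 0" by (simp add: vec_eq_iff)
qed (simp add: hermitian_inner_def)

lemma hermitian_inner_axis: "hermitian_inner (axis v 1) y = y $ v"
proof -
  have "hermitian_inner (axis v 1) y = (\<Sum>i\<in>UNIV. if i = v then y $ i else 0)"
    by (simp only: hermitian_inner_def axis_def vec_lambda_beta, rule sum.cong) auto
  then show ?thesis by simp
qed

text \<open>The difference \<open>x - E *v x\<close> lies in the eigenspace and is orthogonal to it,
  hence to itself.\<close>

lemma orthogonal_projection_fixes:
  assumes "orthogonal_projection_onto E (eigenspace M c)" and "x \<in> eigenspace M c"
  shows "E *v x = x"
proof -
  have "x - E *v x \<in> eigenspace M c"
    using assms unfolding orthogonal_projection_onto_def eigenspace_def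
    by (simp add: matrix_vector_mult_diff_distrib vec_eq_iff algebra_simps)
  then have "hermitian_inner (x - E *v x) (x - E *v x) = 0"
    using assms(1) unfolding orthogonal_projection_onto_def by blast
  then show ?thesis by (simp add: hermitian_inner_self_eq_0)
qed

section \<open>Grover walks\<close>

context
  fixes adj :: "'v::finite \<Rightarrow> 'v \<Rightarrow> bool"
  assumes graph: "simple_graph adj" and no_isolated: "no_isolated_vertices adj"
begin

lemma adj_commute: "adj x y \<longleftrightarrow> adj y x"
  using graph by (auto simp: simple_graph_def dest: sympD)

lemma degree_pos: "degree adj x > 0"
  using no_isolated unfolding no_isolated_vertices_def degree_def
  by (auto simp: card_gt_0_iff)

text \<open>The rows of \<open>N\<close> are orthonormal: distinct rows are supported on arcs with
  distinct heads, and each of the \<open>degree adj x\<close> arcs ending at \<open>x\<close>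
  contributes the reciprocal of the degree.\<close>

lemma boundary_adjoint_boundary:
  "boundary_matrix adj ** adjoint_matrix (boundary_matrix adj) = mat 1"
proof -
  define c where "c x = complex_of_real (1 / sqrt (real (degree adj x)))" for x
  have c: "c x * c x = complex_of_real (1 / real (degree adj x))" for x
    unfolding c_def of_real_mult[symmetric] by simp
  have N: "boundary_matrix adj $ x $ a = (if a \<in> arcs adj \<and> snd a = x then c x else 0)"
    "adjoint_matrix (boundary_matrix adj) $ a $ x = (if a \<in> arcs adj \<and> snd a = x then c x else 0)"
    for x a
    by (auto simp: boundary_matrix_def adjoint_matrix_def c_def)
  have "(boundary_matrix adj ** adjoint_matrix (boundary_matrix adj)) $ x $ y = mat 1 $ x $ y"
    for x y
  proof (cases "x = y")
    case True
    have "card {a \<in> arcs adj. snd a = x} = card {z. adj x z}"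
      by (rule bij_betw_same_card[of fst])
        (auto simp: bij_betw_def inj_on_def image_iff arcs_def adj_commute)
    then have card: "card {a \<in> arcs adj. snd a = x} = degree adj x"
      by (simp add: degree_def)
    have "(boundary_matrix adj ** adjoint_matrix (boundary_matrix adj)) $ x $ y
        = (\<Sum>a\<in>UNIV. if a \<in> arcs adj \<and> snd a = x then c x * c x else 0)"
      by (simp only: matrix_matrix_mult_def vec_lambda_beta, rule sum.cong)
        (auto simp: N True)
    also have "\<dots> = of_nat (degree adj x) * (c x * c x)"
      by (simp add: sum.If_cases card)
    also have "\<dots> = 1"
      using degree_pos[of x] by (simp add: c)
    finally show ?thesis by (simp add: True mat_def)
  next
    case False
    then show ?thesis
      by (simp only: matrix_matrix_mult_def vec_lambda_beta, intro trans[OF sum.neutral])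
        (auto simp: N mat_def)
  qed
  then show ?thesis by (simp add: vec_eq_iff)
qed

section \<open>Shift and coin as involutions of the arc space\<close>

lemma shift_mult_nth:
  "(shift_matrix adj ** M) $ a $ b = (if a \<in> arcs adj then M $ prod.swap a $ b else 0)"
proof -
  have "(shift_matrix adj ** M) $ a $ b
      = (\<Sum>c\<in>UNIV. if c = prod.swap a then (if a \<in> arcs adj then M $ c $ b else 0) else 0)"
    by (simp only: matrix_matrix_mult_def shift_matrix_def arcs_def vec_lambda_beta, rule sum.cong)
      (auto simp: case_prod_beta adj_commute)
  then show ?thesis by simp
qed

lemma arc_identity_mult_nth:
  "(arc_identity adj ** M) $ a $ b = (if a \<in> arcs adj then M $ a $ b else 0)"
proof -
  have "(arc_identity adj ** M) $ a $ b
      = (\<Sum>c\<in>UNIV. if c = a then (if a \<in> arcs adj then M $ c $ b else 0) else 0)"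
    by (simp only: matrix_matrix_mult_def arc_identity_def vec_lambda_beta, rule sum.cong) auto
  then show ?thesis by simp
qed

lemma swap_in_arcs: "prod.swap a \<in> arcs adj \<longleftrightarrow> a \<in> arcs adj"
  by (cases a) (simp add: arcs_def adj_commute)

lemma shift_shift: "shift_matrix adj ** shift_matrix adj = arc_identity adj"
  by (auto simp: vec_eq_iff shift_mult_nth swap_in_arcs)
    (auto simp: shift_matrix_def arc_identity_def swap_in_arcs[of "(_, _)", simplified])

lemma arc_identity_shift: "arc_identity adj ** shift_matrix adj = shift_matrix adj"
  by (auto simp: vec_eq_iff arc_identity_mult_nth) (auto simp: shift_matrix_def)

lemma arc_identity_adjoint_boundary:
  "arc_identity adj ** adjoint_matrix (boundary_matrix adj) = adjoint_matrix (boundary_matrix adj)"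
  by (auto simp: vec_eq_iff arc_identity_mult_nth) (auto simp: boundary_matrix_def adjoint_matrix_def)

lemma arc_identity_idem: "arc_identity adj ** arc_identity adj = arc_identity adj"
  by (auto simp: vec_eq_iff arc_identity_mult_nth) (auto simp: arc_identity_def)

lemma adjoint_shift: "adjoint_matrix (shift_matrix adj) = shift_matrix adj"
  by (auto simp: vec_eq_iff adjoint_matrix_def shift_matrix_def)

lemma adjoint_arc_identity: "adjoint_matrix (arc_identity adj) = arc_identity adj"
  by (auto simp: vec_eq_iff adjoint_matrix_def arc_identity_def)

lemma boundary_arc_identity:
  "boundary_matrix adj ** arc_identity adj = boundary_matrix adj"
proof -
  have "adjoint_matrix (arc_identity adj ** adjoint_matrix (boundary_matrix adj))
      = boundary_matrix adj"
    by (simp add: arc_identity_adjoint_boundary adjoint_adjoint)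
  then show ?thesis
    by (simp add: adjoint_mult adjoint_adjoint adjoint_arc_identity)
qed

lemma adjoint_coin: "adjoint_matrix (coin_matrix adj) = coin_matrix adj"
proof -
  have "adjoint_matrix (2 *\<^sub>R M - L) = 2 *\<^sub>R adjoint_matrix M - adjoint_matrix L"
    for M L :: "complex^('v \<times> 'v)^('v \<times> 'v)"
    by (simp add: adjoint_matrix_def vec_eq_iff)
  then show ?thesis
    by (simp add: coin_matrix_def adjoint_mult adjoint_adjoint adjoint_arc_identity)
qed

text \<open>As \<open>N ** N'\<close> is the identity, \<open>Q = N' ** N\<close> is a projection
  and the coin is the reflection \<open>2Q - I\<close>, whose square is
  \<open>4Q - 4Q + I\<close>.\<close>

lemma coin_coin: "coin_matrix adj ** coin_matrix adj = arc_identity adj"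
proof -
  define N where "N = boundary_matrix adj"
  define Q where "Q = adjoint_matrix N ** N"
  have "Q ** Q = adjoint_matrix N ** (N ** adjoint_matrix N) ** N"
    by (simp add: Q_def matrix_mul_assoc)
  then have QQ: "Q ** Q = Q"
    by (simp add: N_def Q_def boundary_adjoint_boundary)
  have IQ: "arc_identity adj ** Q = Q" "Q ** arc_identity adj = Q"
    by (simp_all add: Q_def N_def matrix_mul_assoc arc_identity_adjoint_boundary)
      (simp add: matrix_mul_assoc[symmetric] boundary_arc_identity)
  have "coin_matrix adj = 2 *\<^sub>R Q - arc_identity adj"
    by (simp add: coin_matrix_def Q_def N_def)
  then show ?thesis
    by (simp only: matrix_diff_distrib matrix_scaleR QQ IQ arc_identity_idem)
      (simp add: vec_eq_iff scaleR_conv_of_real)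
qed

text \<open>Shift and coin are self-adjoint and square to the arc identity. Zero padding makes the
  product of the adjoint of \<open>U\<close> with \<open>U\<close> the arc identity rather than
  \<open>mat 1\<close>.\<close>

lemma time_evolution_isometry:
  "hermitian_inner (time_evolution adj *v x) (time_evolution adj *v y)
    = hermitian_inner x (arc_identity adj *v y)"
proof -
  let ?S = "shift_matrix adj" and ?K = "coin_matrix adj"
  have "(?K ** ?S) ** (?S ** ?K) = ?K ** (?S ** ?S) ** ?K"
    by (simp add: matrix_mul_assoc)
  \<comment> \<open>Both \<open>S ** S\<close> and \<open>K ** K\<close> are the arc identity;
    exchanging one for the other lets the four factors regroup in pairs.\<close>
  also have "\<dots> = ?K ** (?K ** ?K) ** ?K"
    by (simp only: shift_shift coin_coin)
  also have "\<dots> = (?K ** ?K) ** (?K ** ?K)"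
    by (simp add: matrix_mul_assoc)
  finally have "(?K ** ?S) ** (?S ** ?K) = arc_identity adj"
    by (simp only: coin_coin arc_identity_idem)
  then show ?thesis
    by (simp add: hermitian_inner_matrix_left time_evolution_def adjoint_mult adjoint_shift
        adjoint_coin matrix_vector_mul_assoc)
qed

text \<open>Norms are preserved only on the arc space, so membership in it is part of the
  induction.\<close>

lemma time_evolution_power_isometry:
  assumes "arc_identity adj *v x = x"
  shows "arc_identity adj *v (((*v) (time_evolution adj)) ^^ t) x
      = (((*v) (time_evolution adj)) ^^ t) x \<and>
    hermitian_inner ((((*v) (time_evolution adj)) ^^ t) x) ((((*v) (time_evolution adj)) ^^ t) x)
      = hermitian_inner x x"
proof (induction t)
  case (Suc t)
  have "arc_identity adj ** time_evolution adj = time_evolution adj"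
    by (simp add: time_evolution_def matrix_mul_assoc arc_identity_shift)
  with Suc show ?case
    by (simp add: time_evolution_isometry matrix_vector_mul_assoc)
qed (simp add: assms)

text \<open>The coin fixes the columns of \<open>N'\<close>, so the first step is the shift alone.
  Together the two equations say \<open>U U N' = 2 U N' P - N'\<close>, the Chebyshev recurrence
  with \<open>P\<close> acting from the right.\<close>

lemma time_evolution_adjoint_boundary:
  "time_evolution adj ** adjoint_matrix (boundary_matrix adj)
    = shift_matrix adj ** adjoint_matrix (boundary_matrix adj)"
  "time_evolution adj ** (shift_matrix adj ** adjoint_matrix (boundary_matrix adj))
    = 2 *\<^sub>R (shift_matrix adj ** adjoint_matrix (boundary_matrix adj) ** discriminant adj)
      - adjoint_matrix (boundary_matrix adj)"
proof -
  let ?N = "boundary_matrix adj" and ?S = "shift_matrix adj" and ?I = "arc_identity adj"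
  let ?N' = "adjoint_matrix ?N"
  have K: "coin_matrix adj ** X = 2 *\<^sub>R (?N' ** (?N ** X)) - ?I ** X"
    for X :: "complex^'v^('v \<times> 'v)"
    by (simp add: coin_matrix_def matrix_diff_distrib matrix_scaleR matrix_mul_assoc)
  have "coin_matrix adj ** ?N' = ?N'"
    by (simp add: K boundary_adjoint_boundary arc_identity_adjoint_boundary scaleR_2)
  then show "time_evolution adj ** ?N' = ?S ** ?N'"
    by (simp add: time_evolution_def matrix_mul_assoc[symmetric])
  have "coin_matrix adj ** (?S ** ?N') = 2 *\<^sub>R (?N' ** discriminant adj) - ?S ** ?N'"
    by (simp only: K) (simp add: discriminant_def matrix_mul_assoc arc_identity_shift)
  then have "time_evolution adj ** (?S ** ?N')
      = 2 *\<^sub>R (?S ** (?N' ** discriminant adj)) - ?S ** (?S ** ?N')"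
    by (simp add: time_evolution_def matrix_mul_assoc[symmetric] matrix_diff_distrib matrix_scaleR)
  also have "?S ** (?S ** ?N') = ?N'"
    by (simp add: matrix_mul_assoc shift_shift arc_identity_adjoint_boundary)
  finally show "time_evolution adj ** (?S ** ?N')
      = 2 *\<^sub>R (?S ** ?N' ** discriminant adj) - ?N'"
    by (simp add: matrix_mul_assoc)
qed

text \<open>Two factors \<open>U\<close> at the inner end of the power are traded for one factor
  \<open>U\<close> and one \<open>P\<close> acting on \<open>x\<close>. The vector is arbitrary
  because the induction hypothesis is used at \<open>P x\<close> as well as at
  \<open>x\<close>.\<close>

lemma boundary_time_evolution_power:
  "boundary_matrix adj *v (((*v) (time_evolution adj)) ^^ t)
      (adjoint_matrix (boundary_matrix adj) *v x)
    = matpoly (chebyshev_poly t) (discriminant adj) *v x"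
proof (induction t arbitrary: x rule: chebyshev_poly.induct)
  case 1
  show ?case by (simp add: matrix_vector_mul_assoc boundary_adjoint_boundary)
next
  case 2
  show ?case
    by (simp add: matrix_vector_mul_assoc time_evolution_adjoint_boundary discriminant_def
        matrix_mul_assoc mat_zero)
next
  case (3 m)
  let ?N = "boundary_matrix adj" and ?U = "time_evolution adj" and ?P = "discriminant adj"
  let ?N' = "adjoint_matrix ?N"
  have pow_diff: "(((*v) ?U) ^^ n) (2 *\<^sub>R y - z) = 2 *\<^sub>R (((*v) ?U) ^^ n) y - (((*v) ?U) ^^ n) z"
    for n y z
    by (induction n)
      (simp_all add: matrix_vector_mult_diff_distrib matrix_vector_mult_scaleR_right)
  have "?U *v (?U *v (?N' *v x)) = (?U ** (?U ** ?N')) *v x"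
    by (simp add: matrix_vector_mul_assoc matrix_mul_assoc)
  also have "\<dots> = (2 *\<^sub>R (?U ** ?N' ** ?P) - ?N') *v x"
    by (simp only: time_evolution_adjoint_boundary)
  also have "\<dots> = 2 *\<^sub>R (?U *v (?N' *v (?P *v x))) - ?N' *v x"
    by (simp add: matrix_vector_mul_assoc matrix_mul_assoc matrix_vector_mult_diff_rdistrib
        scaleR_matrix_vector_mult)
  finally have UU: "?U *v (?U *v (?N' *v x)) = 2 *\<^sub>R (?U *v (?N' *v (?P *v x))) - ?N' *v x" .
  have "(((*v) ?U) ^^ Suc (Suc m)) (?N' *v x) = (((*v) ?U) ^^ m) (?U *v (?U *v (?N' *v x)))"
    by (simp only: funpow_Suc_right o_apply)
  also have "\<dots> = 2 *\<^sub>R (((*v) ?U) ^^ Suc m) (?N' *v (?P *v x)) - (((*v) ?U) ^^ m) (?N' *v x)"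
    by (simp only: UU pow_diff funpow_Suc_right o_apply)
  finally have "?N *v (((*v) ?U) ^^ Suc (Suc m)) (?N' *v x)
      = 2 *\<^sub>R (matpoly (chebyshev_poly (Suc m)) ?P *v (?P *v x))
        - matpoly (chebyshev_poly m) ?P *v x"
    by (simp only: matrix_vector_mult_diff_distrib matrix_vector_mult_scaleR_right 3)
  also have "2 *\<^sub>R (matpoly (chebyshev_poly (Suc m)) ?P *v (?P *v x))
      = (matpoly (chebyshev_poly (Suc m)) ?P ** (?P ** mat 2)) *v x"
  proof -
    have "(matpoly (chebyshev_poly (Suc m)) ?P ** (?P ** mat 2)) *v x
      = matpoly (chebyshev_poly (Suc m)) ?P *v (?P *v (2 *s x))"
      by (simp only: matrix_vector_mul_assoc[symmetric] mat_mult_vector)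
    also have "\<dots> = 2 *s (matpoly (chebyshev_poly (Suc m)) ?P *v (?P *v x))"
      by (simp only: vector_scalar_commute)
    finally show ?thesis by (simp add: vec_eq_iff scaleR_conv_of_real)
  qed
  also have "\<dots> - matpoly (chebyshev_poly m) ?P *v x
      = matpoly (chebyshev_poly (Suc (Suc m))) ?P *v x"
    by (simp only: chebyshev_poly.simps matpoly_diff matpoly_mult matpoly_pCons)
      (simp add: mat_zero matrix_vector_mult_diff_rdistrib)
  finally show ?case .
qed

text \<open>The converse is the equality case of the Cauchy--Schwarz inequality.\<close>

lemma time_evolution_power_vertex_state_iff:
  assumes "norm \<gamma> = 1"
  shows "(((*v) (time_evolution adj)) ^^ t) (vertex_state adj u) = \<gamma> *s vertex_state adj v
    \<longleftrightarrow> matpoly (chebyshev_poly t) (discriminant adj) *v axis u 1 = \<gamma> *s axis v 1"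
    (is "?w = _ \<longleftrightarrow> ?T = _")
proof
  let ?N = "boundary_matrix adj"
  have Nw: "?N *v ?w = ?T"
    unfolding vertex_state_def by (rule boundary_time_evolution_power)
  have NN: "?N *v vertex_state adj x = axis x 1" for x
    by (simp add: vertex_state_def matrix_vector_mul_assoc boundary_adjoint_boundary)
  \<comment> \<open>Pairing with a vertex state reads off a coordinate after \<open>N\<close>, so
    all inner products below are entries of known vectors.\<close>
  have inner_vs: "hermitian_inner (vertex_state adj x) y = (?N *v y) $ x" for x y
    by (simp add: vertex_state_def hermitian_inner_matrix_left adjoint_adjoint
        hermitian_inner_axis)
  show "?T = \<gamma> *s axis v 1" if "?w = \<gamma> *s vertex_state adj v"
    using Nw that by (simp add: vector_scalar_commute NN)
  show "?w = \<gamma> *s vertex_state adj v" if T: "?T = \<gamma> *s axis v 1"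
  proof -
    have g: "\<gamma> * cnj \<gamma> = 1"
      using assms complex_norm_square[of \<gamma>] by simp
    have "arc_identity adj *v vertex_state adj u = vertex_state adj u"
      by (simp add: vertex_state_def matrix_vector_mul_assoc arc_identity_adjoint_boundary)
    then have ww: "hermitian_inner ?w ?w = 1"
      using time_evolution_power_isometry[of "vertex_state adj u" t]
      by (simp add: inner_vs NN axis_def)
    have vw: "hermitian_inner (vertex_state adj v) ?w = \<gamma>"
      by (simp only: inner_vs Nw T) (simp add: axis_def)
    have wv: "hermitian_inner ?w (vertex_state adj v) = cnj \<gamma>"
      using vw hermitian_inner_commute by metis
    have vv: "hermitian_inner (vertex_state adj v) (vertex_state adj v) = 1"
      by (simp add: inner_vs NN axis_def)
    have scale: "hermitian_inner x (c *s y) = c * hermitian_inner x y"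
      "hermitian_inner (c *s x) y = cnj c * hermitian_inner x y"
      for c and x y :: "complex^('v \<times> 'v)"
      by (simp_all add: hermitian_inner_def sum_distrib_left mult_ac)
    \<comment> \<open>Both states are unit vectors and their inner product is \<gamma>, of modulus
      1; the squared distance expands to 1 - 1 - 1 + 1.\<close>
    have "hermitian_inner (?w - \<gamma> *s vertex_state adj v) (?w - \<gamma> *s vertex_state adj v) = 0"
      by (simp add: hermitian_inner_diff scale ww vw wv vv g mult.commute)
    then show ?thesis by (simp add: hermitian_inner_self_eq_0)
  qed
qed

lemma discriminant_nth:
  "discriminant adj $ x $ y =
    (if adj x y then complex_of_real (1 / sqrt (real (degree adj x) * real (degree adj y))) else 0)"
proof -
  let ?N = "boundary_matrix adj"
  let ?c = "\<lambda>x. complex_of_real (1 / sqrt (real (degree adj x)))"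
  have "discriminant adj $ x $ y
      = (\<Sum>a\<in>UNIV. ?N $ x $ a * (shift_matrix adj ** adjoint_matrix ?N) $ a $ y)"
    by (simp only: discriminant_def matrix_mul_assoc[symmetric])
      (simp only: matrix_matrix_mult_def[of ?N] vec_lambda_beta)
  \<comment> \<open>A contributing arc ends at \<open>x\<close> and its reversal ends at
    \<open>y\<close>.\<close>
  also have "\<dots> = (\<Sum>a\<in>UNIV. if a = (y, x) then (if adj x y then ?c x * ?c y else 0) else 0)"
    unfolding shift_mult_nth
    by (intro sum.cong)
      (auto simp: boundary_matrix_def adjoint_matrix_def arcs_def adj_commute)
  finally show ?thesis by (simp add: real_sqrt_mult)
qed

end

section \<open>Association schemes\<close>

lemma sum_zero_one:
  assumes "finite I" "\<And>i. i \<in> I \<Longrightarrow> f i \<in> {0, 1 :: complex}"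
  shows "sum f I = of_nat (card {i \<in> I. f i = 1})"
proof -
  have "sum f I = (\<Sum>i\<in>I. if f i = 1 then 1 else 0)"
    using assms(2) by (intro sum.cong) auto
  also have "\<dots> = of_nat (card {i \<in> I. f i = 1})"
    using assms(1) by (simp add: sum.If_cases Int_def)
  finally show ?thesis .
qed

text \<open>Connects the coefficient form of the span with the linear algebra of
  \<open>matrix_space\<close>.\<close>

lemma scheme_span_eq_span: "scheme_span d A = matrix_space.span (A ` {..d})"
proof -
  have sum: "(\<chi> x y. \<Sum>i\<le>d. c i * A i $ x $ y) = (\<Sum>i\<le>d. mat (c i) ** A i)" for c
    by (simp add: vec_eq_iff mat_mult_nth)
  have "M \<in> scheme_span d A" if "M \<in> matrix_space.span (A ` {..d})" for M
    using that
  proof (induction rule: matrix_space.span_induct_alt)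
    case base
    show ?case unfolding scheme_span_def by (auto simp: vec_eq_iff intro!: exI[of _ "\<lambda>_. 0"])
  next
    case (step c X Y)
    from step(1) obtain i where i: "i \<le> d" "X = A i" by auto
    from step(2) obtain b where b: "Y = (\<Sum>i\<le>d. mat (b i) ** A i)"
      unfolding scheme_span_def sum by auto
    have "mat c ** X = (\<Sum>j\<le>d. mat (if j = i then c else 0) ** A j)"
    proof -
      have "(\<Sum>j\<le>d. mat (if j = i then c else 0) ** A j) = (\<Sum>j\<le>d. if j = i then mat c ** A j else 0)"
        by (intro sum.cong) (auto simp: mat_zero)
      then show ?thesis using i by simp
    qed
    then have eq: "mat c ** X + Y = (\<Sum>j\<le>d. mat ((if j = i then c else 0) + b j) ** A j)"
      by (simp only: b sum.distrib[symmetric] matrix_add_rdistrib[symmetric] mat_add[symmetric])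
    show ?case unfolding scheme_span_def sum by (rule CollectI, rule exI, rule eq)
  qed
  moreover have "M \<in> matrix_space.span (A ` {..d})" if "M \<in> scheme_span d A" for M
  proof -
    from that obtain b where "M = (\<Sum>i\<le>d. mat (b i) ** A i)"
      unfolding scheme_span_def sum by auto
    also have "\<dots> \<in> matrix_space.span (A ` {..d})"
      by (intro matrix_space.span_sum matrix_space.span_scale matrix_space.span_base) auto
    finally show ?thesis .
  qed
  ultimately show ?thesis by blast
qed

context
  fixes A :: "nat \<Rightarrow> complex^'v::finite^'v" and d :: nat
  assumes scheme: "association_scheme d A"
begin

section \<open>Classes as a partition of the vertex pairs, and their valencies\<close>

lemma scheme_01: "i \<le> d \<Longrightarrow> A i $ x $ y \<in> {0, 1}"
  using scheme unfolding association_scheme_def by blast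

lemma scheme_symmetric: "i \<le> d \<Longrightarrow> A i $ x $ y = A i $ y $ x"
proof -
  assume "i \<le> d"
  then have "transpose (A i) = A i"
    using scheme unfolding association_scheme_def by blast
  moreover have "transpose (A i) $ x $ y = A i $ y $ x"
    by (simp add: transpose_def)
  ultimately show ?thesis by (simp only:)
qed

lemma scheme_A0: "A 0 = mat 1"
  using scheme unfolding association_scheme_def by blast

lemma scheme_class_mult: "i \<le> d \<Longrightarrow> j \<le> d \<Longrightarrow> A i ** A j \<in> scheme_span d A"
  using scheme unfolding association_scheme_def by blast

text \<open>At each position the entries are 0 or 1 and sum to 1, so exactly one class is nonzero
  there.\<close>

lemma scheme_class:
  shows "\<exists>i\<le>d. \<forall>j\<le>d. A j $ x $ y = (if j = i then 1 else 0)"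
proof -
  have "(\<Sum>i\<le>d. A i) = (\<chi> x y. 1)"
    using scheme unfolding association_scheme_def by (elim conjE)
  then have "(\<Sum>i\<le>d. A i) $ x $ y = 1" by (simp only: vec_lambda_beta)
  then have "(\<Sum>i\<le>d. A i $ x $ y) = 1" by simp
  moreover have "(\<Sum>i\<le>d. A i $ x $ y) = of_nat (card {i \<in> {..d}. A i $ x $ y = 1})"
    by (intro sum_zero_one scheme_01) auto
  ultimately have "(of_nat (card {i \<in> {..d}. A i $ x $ y = 1}) :: complex) = 1"
    by (simp only:)
  then have "card {i \<in> {..d}. A i $ x $ y = 1} = 1"
    by (simp only: of_nat_eq_1_iff)
  then obtain i where i: "{i \<in> {..d}. A i $ x $ y = 1} = {i}"
    by (auto simp: card_1_singleton_iff)
  have "A j $ x $ y = (if j = i then 1 else 0)" if "j \<le> d" for j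
    using scheme_01[OF that, of x y] that i by auto
  moreover have "i \<le> d" using i by auto
  ultimately show ?thesis by blast
qed

text \<open>All other classes vanish at this position; coefficients can therefore be read off
  entries.\<close>

lemma scheme_combination_nth:
  assumes "i \<le> d" "A i $ x $ y = 1"
  shows "(\<Sum>j\<le>d. c j * A j $ x $ y) = c i"
proof -
  obtain k where "\<forall>j\<le>d. A j $ x $ y = (if j = k then 1 else 0)"
    using scheme_class[of x y] by blast
  then have k: "A j $ x $ y = (if j = k then 1 else 0)" if "j \<le> d" for j
    using that by blast
  have "k = i" using k[OF assms(1)] assms(2) by (auto split: if_splits)
  have "(\<Sum>j\<le>d. c j * A j $ x $ y) = (\<Sum>j\<le>d. if j = i then c j else 0)"
    using k \<open>k = i\<close> by (intro sum.cong) auto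
  then show ?thesis using assms by simp
qed

lemma scheme_row_sum:
  assumes "l \<le> d"
  shows "(\<Sum>y\<in>UNIV. A l $ x $ y) = of_nat (card {y. A l $ x $ y = 1})"
proof -
  have "(\<Sum>y\<in>UNIV. A l $ x $ y) = of_nat (card {y \<in> UNIV. A l $ x $ y = 1})"
    by (intro sum_zero_one scheme_01 assms) simp
  then show ?thesis by simp
qed

text \<open>The row sums of \<open>A l\<close> are the diagonal entries of its square, and matrices in the span
  have constant diagonal.\<close>

lemma scheme_valency:
  assumes "l \<le> d"
  obtains k where "\<And>x. card {y. A l $ x $ y = 1} = k"
proof -
  have "A l ** A l \<in> scheme_span d A"
    using scheme_class_mult assms by blast
  then obtain c where c: "A l ** A l = (\<chi> x y. \<Sum>i\<le>d. c i * A i $ x $ y)"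
    unfolding scheme_span_def by blast
  have "of_nat (card {y. A l $ x $ y = 1}) = c 0" for x
  proof -
    have "A l $ x $ y = A l $ x $ y * A l $ y $ x" for y
      using scheme_01[OF assms, of x y] scheme_symmetric[OF assms, of x y] by auto
    then have "(\<Sum>y\<in>UNIV. A l $ x $ y) = (\<Sum>y\<in>UNIV. A l $ x $ y * A l $ y $ x)"
      by (rule sum.cong[OF refl])
    also have "\<dots> = (A l ** A l) $ x $ x"
      by (simp add: matrix_matrix_mult_def)
    also have "\<dots> = c 0"
      using scheme_combination_nth[of 0 x x c] by (simp add: c scheme_A0 mat_def)
    finally show ?thesis using scheme_row_sum[OF assms] by simp
  qed
  \<comment> \<open>\<open>undefined\<close> merely names a reference vertex.\<close>
  then have "(of_nat (card {y. A l $ x $ y = 1}) :: complex)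
      = of_nat (card {y. A l $ undefined $ y = 1})" for x
    by (simp only:)
  then have "card {y. A l $ x $ y = 1} = card {y. A l $ undefined $ y = 1}" for x
    by (simp only: of_nat_eq_iff)
  then show ?thesis by (rule that)
qed

section \<open>The span as an algebra\<close>

lemma scheme_span_mult:
  assumes "X \<in> scheme_span d A" "Y \<in> scheme_span d A"
  shows "X ** Y \<in> scheme_span d A"
proof -
  have base: "X ** Y \<in> scheme_span d A" if "X \<in> A ` {..d}" "Y \<in> A ` {..d}" for X Y
    using that scheme_class_mult by auto
  \<comment> \<open>Bilinearity is used one factor at a time: first the right factor ranges over the
    span, then the left.\<close>
  have right: "X ** Y \<in> scheme_span d A" if "X \<in> A ` {..d}" "Y \<in> scheme_span d A" for X Y
    using that(2) unfolding scheme_span_eq_span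
  proof (induction rule: matrix_space.span_induct_alt)
    case base
    show ?case by (simp add: matrix_space.span_zero)
  next
    case (step c Z W)
    have "X ** (mat c ** Z + W) = mat c ** (X ** Z) + X ** W"
      by (simp add: matrix_add_ldistrib matrix_mul_assoc mat_mult_commute)
    then show ?case
      using step base[OF that(1) step(1)]
      by (simp add: matrix_space.span_add matrix_space.span_scale scheme_span_eq_span)
  qed
  show ?thesis
    using assms(1) unfolding scheme_span_eq_span
  proof (induction rule: matrix_space.span_induct_alt)
    case base
    show ?case by (simp add: matrix_space.span_zero)
  next
    case (step c Z W)
    have "(mat c ** Z + W) ** Y = mat c ** (Z ** Y) + W ** Y"
      by (simp add: matrix_add_rdistrib matrix_mul_assoc)
    then show ?case
      using step right[OF step(1) assms(2)]
      by (simp add: matrix_space.span_add matrix_space.span_scale scheme_span_eq_span)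
  qed
qed

lemma mat_in_scheme_span: "mat c \<in> scheme_span d A"
proof -
  have "mat c ** A 0 \<in> scheme_span d A"
    unfolding scheme_span_eq_span
    by (intro matrix_space.span_scale matrix_space.span_base) auto
  then show ?thesis by (simp add: scheme_A0)
qed

lemma matpoly_in_scheme_span:
  assumes "P \<in> scheme_span d A"
  shows "matpoly p P \<in> scheme_span d A"
proof (induction p)
  case 0
  show ?case by (simp add: scheme_span_eq_span matrix_space.span_zero)
next
  case (pCons c p)
  show ?case
    using mat_in_scheme_span[of c] scheme_span_mult[OF assms pCons.IH]
    by (simp add: scheme_span_eq_span matrix_space.span_add)
qed

text \<open>The span is generated by \<open>d + 1\<close> matrices, so \<open>d + 2\<close> members
  cannot be independent. The family is indexed, so repeated members need a case of their
  own.\<close>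

lemma scheme_span_dependent:
  fixes w :: "nat \<Rightarrow> complex^'v^'v"
  assumes w: "\<And>i. i \<le> Suc d \<Longrightarrow> w i \<in> scheme_span d A"
  obtains b where "\<exists>i\<le>Suc d. b i \<noteq> 0" "(\<Sum>i\<le>Suc d. mat (b i) ** w i) = 0"
proof (cases "inj_on w {..Suc d}")
  case True
  have "matrix_space.dependent (w ` {..Suc d})"
  proof (rule ccontr)
    assume "matrix_space.independent (w ` {..Suc d})"
    moreover have "w ` {..Suc d} \<subseteq> matrix_space.span (A ` {..d})"
      using w by (auto simp: scheme_span_eq_span)
    ultimately have "card (w ` {..Suc d}) \<le> card (A ` {..d})"
      using matrix_space.independent_span_bound[of "A ` {..d}" "w ` {..Suc d}"] by simp
    also have "\<dots> \<le> Suc d" using card_image_le[of "{..d}" A] by simp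
    finally show False using True by (simp add: card_image)
  qed
  then obtain f where f: "\<exists>v\<in>w ` {..Suc d}. f v \<noteq> 0" "(\<Sum>v\<in>w ` {..Suc d}. mat (f v) ** v) = 0"
    by (auto simp: matrix_space.dependent_finite)
  then have "(\<Sum>i\<le>Suc d. mat (f (w i)) ** w i) = 0"
    by (simp add: sum.reindex[OF True] o_def del: sum.atMost_Suc)
  with f(1) show ?thesis by (intro that[of "f \<circ> w"]) (auto simp del: sum.atMost_Suc)
next
  case False
  then obtain i j where ij: "i \<le> Suc d" "j \<le> Suc d" "i \<noteq> j" "w i = w j"
    by (auto simp: inj_on_def)
  \<comment> \<open>Coefficients 1 and -1 at the two equal members cancel.\<close>
  define b where "b k = (if k = i then 1 else 0) - (if k = j then 1 else (0::complex))" for k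
  have "(\<Sum>k\<le>Suc d. mat (b k) ** w k)
      = (\<Sum>k\<le>Suc d. (if k = i then w k else 0) - (if k = j then w k else 0))"
    by (intro sum.cong) (auto simp: b_def vec_eq_iff mat_mult_nth)
  also have "\<dots> = 0"
    using ij by (simp add: sum_subtractf del: sum.atMost_Suc)
  finally show ?thesis using ij by (intro that[of b]) (auto simp: b_def simp del: sum.atMost_Suc)
qed

text \<open>When \<open>P\<close> has \<open>d + 1\<close> distinct eigenvalues, the powers \<open>P\<^sup>0, \<dots>, P\<^sup>d\<close> are independent and so
  exhaust the span by dimension. Hence the span consists of polynomials in \<open>P\<close>, and such a
  polynomial is determined by its values at the eigenvalues, without appeal to the spectral
  theorem.\<close>

context
  fixes P :: "complex^'v^'v" and \<mu> :: "nat \<Rightarrow> complex"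
  assumes P: "P \<in> scheme_span d A"
    and inj: "inj_on \<mu> {..d}"
    and ev: "\<mu> ` {..d} \<subseteq> eigenvalues P"
begin

lemma poly_eigenvalue_eq_0:
  assumes "matpoly p P = 0" "j \<le> d"
  shows "poly p (\<mu> j) = 0"
proof -
  obtain x where x: "x \<noteq> 0" "P *v x = \<mu> j *s x"
    using ev assms(2) unfolding eigenvalues_def by auto
  have "poly p (\<mu> j) *s x = 0"
    using matpoly_eigenvector[OF x(2), of p] assms(1) by simp
  with x(1) show ?thesis by simp
qed

text \<open>The \<open>d + 1\<close> distinct eigenvalues are roots of a nonzero polynomial.\<close>

lemma degree_gt_if_vanishes:
  assumes "\<And>j. j \<le> d \<Longrightarrow> poly p (\<mu> j) = 0" "p \<noteq> 0"
  shows "Polynomial.degree p > d"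
proof -
  have "\<mu> ` {..d} \<subseteq> {x. poly p x = 0}" using assms(1) by auto
  then have "card (\<mu> ` {..d}) \<le> card {x. poly p x = 0}"
    by (intro card_mono poly_roots_finite assms(2))
  also have "\<dots> \<le> Polynomial.degree p" using assms(2) by (rule card_poly_roots_bound)
  finally show ?thesis using inj by (simp add: card_image)
qed

text \<open>Dependence of the powers of \<open>P\<close> up to exponent \<open>d + 1\<close> gives a
  nonzero annihilator \<open>m\<close> of degree at most \<open>d + 1\<close>, which vanishes at
  every eigenvalue. The remainder of \<open>p\<close> modulo \<open>m\<close> then has
  \<open>d + 1\<close> roots but degree at most \<open>d\<close>, so \<open>m\<close> divides
  \<open>p\<close>.\<close>

lemma matpoly_eq_0_if_vanishes:
  assumes "\<And>j. j \<le> d \<Longrightarrow> poly p (\<mu> j) = 0"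
  shows "matpoly p P = 0"
proof -
  have "matpoly (monom 1 i) P \<in> scheme_span d A" if "i \<le> Suc d" for i
    by (rule matpoly_in_scheme_span[OF P])
  then obtain b where b: "\<exists>i\<le>Suc d. b i \<noteq> 0"
    "(\<Sum>i\<le>Suc d. mat (b i) ** matpoly (monom 1 i) P) = 0"
    by (rule scheme_span_dependent[of "\<lambda>i. matpoly (monom 1 i) P"])
  define m where "m = (\<Sum>i\<le>Suc d. monom (b i) i)"
  have coeff: "coeff m k = (if k \<le> Suc d then b k else 0)" for k
    by (simp add: m_def coeff_sum del: sum.atMost_Suc)
  have m0: "m \<noteq> 0" using b(1) coeff by (metis coeff_0)
  have "matpoly m P = (\<Sum>i\<le>Suc d. matpoly (smult (b i) (monom 1 i)) P)"
    unfolding m_def by (simp only: matpoly_sum smult_monom mult_1_right)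
  then have mP: "matpoly m P = 0"
    by (simp only: matpoly_smult b(2))
  have deg: "Polynomial.degree m \<le> Suc d"
    by (rule degree_le) (simp add: coeff)
  define r where "r = p mod m"
  have "poly r (\<mu> j) = 0" if "j \<le> d" for j
    using assms[OF that] poly_eigenvalue_eq_0[OF mP that]
    by (metis r_def poly_mod)
  then have "Polynomial.degree r > d" if "r \<noteq> 0"
    using degree_gt_if_vanishes that by blast
  moreover have "r = 0 \<or> Polynomial.degree r < Polynomial.degree m"
    unfolding r_def using degree_mod_less[OF m0] by blast
  ultimately have "r = 0" using deg by linarith
  then have "p = p div m * m"
    unfolding r_def by (metis add.right_neutral div_mult_mod_eq)
  then have "matpoly p P = matpoly (p div m) P ** matpoly m P"
    by (metis matpoly_mult)
  then show ?thesis by (simp add: mP)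
qed

text \<open>The powers of \<open>P\<close> up to exponent \<open>d\<close>, together with
  \<open>B\<close>, are dependent. If \<open>B\<close> had coefficient 0, a nonzero polynomial of
  degree at most \<open>d\<close> would annihilate \<open>P\<close> and have \<open>d + 1\<close>
  roots; so the relation can be solved for \<open>B\<close>.\<close>

lemma scheme_span_matpoly:
  assumes "B \<in> scheme_span d A"
  obtains q where "B = matpoly q P"
proof -
  define w where "w i = (if i \<le> d then matpoly (monom 1 i) P else B)" for i
  have "w i \<in> scheme_span d A" if "i \<le> Suc d" for i
    using assms matpoly_in_scheme_span[OF P] by (simp add: w_def)
  then obtain b where b: "\<exists>i\<le>Suc d. b i \<noteq> 0" "(\<Sum>i\<le>Suc d. mat (b i) ** w i) = 0"
    by (rule scheme_span_dependent[of w])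
  define m where "m = (\<Sum>i\<le>d. monom (b i) i)"
  have coeff: "coeff m k = (if k \<le> d then b k else 0)" for k
    by (simp add: m_def coeff_sum)
  have "matpoly m P = (\<Sum>i\<le>d. matpoly (smult (b i) (monom 1 i)) P)"
    unfolding m_def by (simp only: matpoly_sum smult_monom mult_1_right)
  then have sum: "matpoly m P + mat (b (Suc d)) ** B = 0"
    using b(2) by (simp add: matpoly_smult w_def)
  have nz: "b (Suc d) \<noteq> 0"
  proof
    assume z: "b (Suc d) = 0"
    then have "m \<noteq> 0" using b(1) coeff by (metis coeff_0 le_Suc_eq)
    moreover have "matpoly m P = 0" using sum z by (simp add: mat_zero)
    ultimately have "Polynomial.degree m > d"
      using degree_gt_if_vanishes poly_eigenvalue_eq_0 by blast
    moreover have "Polynomial.degree m \<le> d" by (rule degree_le) (simp add: coeff)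
    ultimately show False by simp
  qed
  have "mat (b (Suc d)) ** B = - matpoly m P"
    using sum by (simp add: eq_neg_iff_add_eq_0 add.commute)
  then have "mat (- inverse (b (Suc d))) ** matpoly m P = B"
    by (auto simp: vec_eq_iff mat_mult_nth) (use nz in \<open>simp add: field_simps\<close>)
  then show ?thesis
    using that[of "smult (- inverse (b (Suc d))) m"] by (simp only: matpoly_smult)
qed

end

text \<open>If \<open>T\<close> maps \<open>e\<^sub>u\<close> to a nonzero multiple of \<open>e\<^sub>v\<close>, the class of \<open>(u, v)\<close> has valency 1, while
  every other class that occurs in \<open>T\<close> vanishes on column \<open>u\<close> and hence everywhere.\<close>

lemma scheme_span_column:
  assumes T: "T \<in> scheme_span d A" and col: "T *v axis u 1 = \<gamma> *s axis v 1"
    and "\<gamma> \<noteq> 0" "u \<noteq> v"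
  obtains i where "i \<le> d" "fixed_point_free_involution_matrix (A i)" "A i $ u $ v = 1"
    "T = mat \<gamma> ** A i"
proof -
  obtain c where c: "T = (\<chi> x y. \<Sum>i\<le>d. c i * A i $ x $ y)"
    using T unfolding scheme_span_def by auto
  have Tu: "T $ x $ u = (if x = v then \<gamma> else 0)" for x
  proof -
    have "T $ x $ u = (T *v axis u 1) $ x"
      by (simp only: matrix_vector_mult_axis_nth)
    then show ?thesis by (simp only: col) (simp add: axis_def)
  qed
  obtain i where i: "i \<le> d" and "\<forall>j\<le>d. A j $ v $ u = (if j = i then 1 else 0)"
    using scheme_class[of v u] by blast
  then have cls: "A j $ v $ u = (if j = i then 1 else 0)" if "j \<le> d" for j
    using that by blast
  have coef: "T $ x $ y = c l" if "l \<le> d" "A l $ x $ y = 1" for l x y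
    using scheme_combination_nth[OF that] by (simp add: c)
  have ci: "c i = \<gamma>" using coef[of i v u] cls[OF i] i Tu by simp
  have other: "A l = 0" if l: "l \<le> d" "l \<noteq> i" "c l \<noteq> 0" for l
  proof -
    obtain k where k: "\<And>x. card {y. A l $ x $ y = 1} = k"
      using scheme_valency[OF l(1)] by metis
    have "A l $ u $ x \<noteq> 1" for x
      using coef[OF l(1), of x u] Tu[of x] l cls[OF l(1)] scheme_symmetric[OF l(1), of u x]
      by (auto split: if_splits)
    then have "k = 0" using k[of u] by simp
    then have "A l $ x $ y \<noteq> 1" for x y using k[of x] by auto
    then show ?thesis using scheme_01[OF l(1)] by (auto simp: vec_eq_iff)
  qed
  have "T $ x $ y = (mat \<gamma> ** A i) $ x $ y" for x y
  proof -
    have "(\<Sum>l\<le>d. c l * A l $ x $ y) = (\<Sum>l\<le>d. if l = i then c l * A l $ x $ y else 0)"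
      using other by (intro sum.cong) (auto, metis mult_zero_right zero_index)
    then show ?thesis using i by (simp add: c ci mat_mult_nth)
  qed
  then have TA: "T = mat \<gamma> ** A i" by (simp add: vec_eq_iff)
  obtain k where k: "\<And>x. card {y. A i $ x $ y = 1} = k"
    using scheme_valency[OF i] by metis
  have uv: "A i $ u $ v = 1" using cls[OF i] scheme_symmetric[OF i, of u v] by simp
  \<comment> \<open>By symmetry such an entry also occurs in column \<open>u\<close>, where it
    contributes \<gamma> to \<open>T\<close>; this happens only in row \<open>v\<close>.\<close>
  have "y = v" if "A i $ u $ y = 1" for y
  proof -
    have "A i $ y $ u = 1" using that scheme_symmetric[OF i, of u y] by simp
    then have "T $ y $ u \<noteq> 0" using coef[OF i] ci \<open>\<gamma> \<noteq> 0\<close> by simp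
    then show ?thesis using Tu by (simp split: if_splits)
  qed
  with uv have "{y. A i $ u $ y = 1} = {v}" by blast
  then have "k = 1" using k[of u] by simp
  then have "\<exists>y. {y. A i $ x $ y = 1} = {y}" for x
    using k[of x] by (simp add: card_1_singleton_iff)
  then obtain \<sigma> where \<sigma>: "\<forall>x. {y. A i $ x $ y = 1} = {\<sigma> x}"
    using choice[of "\<lambda>x z. {y. A i $ x $ y = 1} = {z}"] by blast
  have iff: "A i $ x $ y = 1 \<longleftrightarrow> y = \<sigma> x" for x y
    using \<sigma>[THEN spec, of x] by blast
  have "A 0 $ u $ v = 0" using \<open>u \<noteq> v\<close> by (simp add: scheme_A0 mat_def)
  with uv have "i \<noteq> 0" by (metis zero_neq_one)
  \<comment> \<open>Diagonal positions belong to class 0. Otherwise the combination with coefficient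
    1 at \<open>i\<close> and 0 elsewhere would read 1 through class \<open>i\<close> and 0 through
    class 0.\<close>
  have "A i $ x $ x \<noteq> 1" for x
  proof
    assume "A i $ x $ x = 1"
    then have "(\<Sum>j\<le>d. (if j = i then 1 else 0) * A j $ x $ x) = 1"
      using scheme_combination_nth[OF i, of x x "\<lambda>j. if j = i then 1 else 0"] by simp
    moreover have "(\<Sum>j\<le>d. (if j = i then 1 else 0) * A j $ x $ x) = 0"
      using scheme_combination_nth[of 0 x x "\<lambda>j. if j = i then 1 else 0"] \<open>i \<noteq> 0\<close>
      by (simp add: scheme_A0 mat_def)
    ultimately show False by simp
  qed
  then have "\<sigma> x \<noteq> x" for x using iff[of x x] by metis
  moreover have "\<sigma> (\<sigma> x) = x" for x
    using iff[of x "\<sigma> x"] iff[of "\<sigma> x" x] scheme_symmetric[OF i, of x "\<sigma> x"] by simp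
  moreover have "A i $ x $ y = (if y = \<sigma> x then 1 else 0)" for x y
    using iff[of x y] scheme_01[OF i, of x y] by auto
  then have "A i = (\<chi> x y. if y = \<sigma> x then 1 else 0)" by (simp add: vec_eq_iff)
  ultimately have "fixed_point_free_involution_matrix (A i)"
    unfolding fixed_point_free_involution_matrix_def by (intro exI[of _ \<sigma>]) simp
  with i show ?thesis using uv TA by (rule that)
qed

text \<open>Constant valencies give all members of the span constant row sums. The graph is thus
  regular, and \<open>P\<close> is its adjacency matrix divided by the degree.\<close>

lemma scheme_graph_discriminant:
  fixes adj :: "'v \<Rightarrow> 'v \<Rightarrow> bool"
  assumes "simple_graph adj" "no_isolated_vertices adj" "graph_belongs_to_scheme adj d A"
  shows "discriminant adj \<in> scheme_span d A"
    and "discriminant adj *v 1 = 1"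
proof -
  obtain c where c: "adjacency_matrix adj = (\<chi> x y. \<Sum>i\<le>d. c i * A i $ x $ y)"
    using assms(3) unfolding graph_belongs_to_scheme_def scheme_span_def by auto
  have "\<exists>k. \<forall>x. card {y. A l $ x $ y = 1} = k" if "l \<le> d" for l
    using scheme_valency[OF that] by metis
  then obtain k where k: "\<And>l x. l \<le> d \<Longrightarrow> card {y. A l $ x $ y = 1} = k l" by metis
  have "of_nat (degree adj x) = (\<Sum>i\<le>d. c i * of_nat (k i))" for x
  proof -
    have "of_nat (degree adj x) = (\<Sum>y\<in>UNIV. adjacency_matrix adj $ x $ y)"
      by (simp add: adjacency_matrix_def degree_def sum.If_cases)
    also have "\<dots> = (\<Sum>i\<le>d. \<Sum>y\<in>UNIV. c i * A i $ x $ y)"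
      unfolding c by (simp, rule sum.swap)
    also have "\<dots> = (\<Sum>i\<le>d. c i * of_nat (k i))"
      by (intro sum.cong) (auto simp: sum_distrib_left[symmetric] scheme_row_sum k)
    finally show ?thesis .
  qed
  then have "degree adj x = degree adj y" for x y
    by (metis of_nat_eq_iff)
  then obtain r where r: "\<And>x. degree adj x = r" by metis
  have rpos: "r > 0" using degree_pos[OF assms(1,2)] r by metis
  have nth: "discriminant adj $ x $ y = (if adj x y then 1 / of_nat r else 0)" for x y
    by (simp add: discriminant_nth[OF assms(1,2)] r)
  then have "discriminant adj = mat (1 / of_nat r) ** adjacency_matrix adj"
    by (simp add: vec_eq_iff mat_mult_nth adjacency_matrix_def)
  then show "discriminant adj \<in> scheme_span d A"
    using assms(3) unfolding graph_belongs_to_scheme_def scheme_span_eq_span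
    by (simp add: matrix_space.span_scale)
  have "(discriminant adj *v 1) $ x = 1" for x
    using r[of x] rpos
    by (simp add: matrix_vector_mult_def nth sum.If_cases degree_def)
  then show "discriminant adj *v 1 = 1" by (simp add: vec_eq_iff)
qed

end

section \<open>Involution classes and perfect state transfer\<close>

lemma fixed_point_free_involution_matrix_square:
  assumes "fixed_point_free_involution_matrix B"
  shows "B ** B = mat 1"
proof -
  obtain \<sigma> where \<sigma>: "\<And>x. \<sigma> (\<sigma> x) = x" "B = (\<chi> x y. if y = \<sigma> x then 1 else 0)"
    using assms unfolding fixed_point_free_involution_matrix_def by auto
  have "(B ** B) $ x $ y = (\<Sum>k\<in>UNIV. if k = \<sigma> x then (if y = \<sigma> k then 1 else 0) else 0)" for x y
    by (simp only: matrix_matrix_mult_def \<sigma>(2) vec_lambda_beta, rule sum.cong) auto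
  then show ?thesis by (auto simp: vec_eq_iff mat_def \<sigma>(1))
qed

lemma fixed_point_free_involution_matrix_axis:
  assumes "fixed_point_free_involution_matrix B" "B $ u $ v = 1"
  shows "B *v axis u 1 = axis v 1"
proof -
  obtain \<sigma> where \<sigma>: "\<And>x. \<sigma> (\<sigma> x) = x" "B = (\<chi> x y. if y = \<sigma> x then 1 else 0)"
    using assms unfolding fixed_point_free_involution_matrix_def by auto
  have "v = \<sigma> u" using assms(2) by (auto simp: \<sigma>(2) split: if_splits)
  then show ?thesis
    by (auto simp: vec_eq_iff matrix_vector_mult_axis_nth)
      (auto simp: \<sigma> axis_def)
qed

theorem theorem3p7:
  fixes adj :: "'v::finite \<Rightarrow> 'v \<Rightarrow> bool"
    and d \<tau> :: nat
    and A E :: "nat \<Rightarrow> complex^'v^'v"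
    and \<mu> :: "nat \<Rightarrow> real"
    and u v :: 'v
  assumes "simple_graph adj"
    and "no_isolated_vertices adj"
    and "association_scheme d A"
    and "graph_belongs_to_scheme adj d A"
    and "eigenvalues (discriminant adj) = (\<lambda>j. complex_of_real (\<mu> j)) ` {..d}"
    and "strict_antimono_on {..d} \<mu>"
    and "\<And>j. j \<le> d \<Longrightarrow>
           orthogonal_projection_onto (E j) (eigenspace (discriminant adj) (complex_of_real (\<mu> j)))"
    and "u \<noteq> v"
    and "\<tau> > 0"
  shows "perfect_state_transfer adj u v \<tau> \<longleftrightarrow>
    (\<exists>B \<in> A ` {..d}.
       fixed_point_free_involution_matrix B \<and> B $ u $ v = 1 \<and>
       (\<forall>j \<in> plus_indices d E B. chebyshev_T \<tau> (\<mu> j) = 1) \<and>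
       (\<forall>j \<in> minus_indices d E B. chebyshev_T \<tau> (\<mu> j) = -1))"
proof -
  note scheme = assms(3)
  define P where "P = discriminant adj"
  define T where "T = matpoly (chebyshev_poly \<tau>) P"
  have P: "P \<in> scheme_span d A" and P1: "P *v 1 = 1"
    unfolding P_def using scheme_graph_discriminant[OF scheme assms(1,2,4)] by auto
  have inj: "inj_on (\<lambda>j. complex_of_real (\<mu> j)) {..d}"
  proof (rule inj_onI)
    fix i j assume "i \<in> {..d}" "j \<in> {..d}" "complex_of_real (\<mu> i) = complex_of_real (\<mu> j)"
    then show "i = j"
      using assms(6) unfolding monotone_on_def
      by (metis less_irrefl linorder_neqE_nat of_real_eq_iff)
  qed
  have ev: "(\<lambda>j. complex_of_real (\<mu> j)) ` {..d} \<subseteq> eigenvalues P"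
    using assms(5) by (simp add: P_def)
  have PE: "P *v (E j *v x) = complex_of_real (\<mu> j) *s (E j *v x)" if "j \<le> d" for j x
    using assms(7)[OF that] unfolding orthogonal_projection_onto_def eigenspace_def P_def by blast
  have polyE: "matpoly p P *v (E j *v x) = poly p (complex_of_real (\<mu> j)) *s (E j *v x)"
    if "j \<le> d" for p j x
    using PE[OF that] by (rule matpoly_eigenvector)
  \<comment> \<open>An eigenvector is fixed by its projection; a nonzero vector in the range of
    \<open>E j\<close> allows scalars to be compared below.\<close>
  have E_nonzero: "\<exists>x. E j *v x \<noteq> 0" if j: "j \<le> d" for j
  proof -
    obtain x where x: "x \<noteq> 0" "x \<in> eigenspace P (complex_of_real (\<mu> j))"
      using ev j unfolding eigenvalues_def eigenspace_def by auto
    then show ?thesis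
      using orthogonal_projection_fixes[OF assms(7)[OF j]] unfolding P_def by metis
  qed
  have neg: "(- X) *v x = (-1) *s (X *v x)" for X :: "complex^'v^'v" and x
    by (simp add: vec_eq_iff matrix_vector_mult_def sum_negf)
  have pst: "perfect_state_transfer adj u v \<tau> \<longleftrightarrow>
      (\<exists>\<gamma>. norm \<gamma> = 1 \<and> T *v axis u 1 = \<gamma> *s axis v 1)"
    unfolding perfect_state_transfer_def T_def P_def
    using time_evolution_power_vertex_state_iff[OF assms(1,2)] assms(8) by auto
  show ?thesis
  proof
    assume "perfect_state_transfer adj u v \<tau>"
    then obtain \<gamma> where \<gamma>: "norm \<gamma> = 1" "T *v axis u 1 = \<gamma> *s axis v 1"
      using pst by blast
    have "T \<in> scheme_span d A"
      unfolding T_def by (rule matpoly_in_scheme_span[OF scheme P])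
    then obtain i where i: "i \<le> d" "fixed_point_free_involution_matrix (A i)"
      "A i $ u $ v = 1" "T = mat \<gamma> ** A i"
      using scheme_span_column[OF scheme _ \<gamma>(2) _ assms(8)] \<gamma>(1)
      by (metis norm_zero zero_neq_one)
    \<comment> \<open>The all-ones vector \<open>1\<close> determines the phase: \<open>T\<close>
      fixes it because its eigenvalue for \<open>P\<close> is 1 and Chebyshev polynomials take the
      value 1 there, while the permutation matrix \<open>A i\<close> fixes it too.\<close>
    have "T *v 1 = poly (chebyshev_poly \<tau>) 1 *s 1"
      unfolding T_def using P1 by (intro matpoly_eigenvector) simp
    also have "poly (chebyshev_poly \<tau>) 1 = 1"
      using poly_chebyshev_poly[of \<tau> 1] by (simp add: chebyshev_T_1)
    finally have T1: "T *v 1 = 1" by simp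
    have Ai1: "A i *v 1 = 1"
    proof -
      obtain \<sigma> where "A i = (\<chi> x y. if y = \<sigma> x then 1 else 0)"
        using i(2) unfolding fixed_point_free_involution_matrix_def by auto
      then show ?thesis by (simp add: matrix_vector_mult_def vec_eq_iff)
    qed
    have "T *v 1 = \<gamma> *s (A i *v 1)"
      by (simp only: i(4) matrix_vector_mul_assoc[symmetric] mat_mult_vector)
    then have "\<gamma> = 1" by (simp add: T1 Ai1 vec_eq_iff)
    then have TA: "T = A i" using i(4) by simp
    \<comment> \<open>On the range of \<open>E j\<close>, the matrix \<open>T = A i\<close> acts
      both as the Chebyshev value at \<open>\<mu> j\<close> and as the sign
      \<open>c\<close>.\<close>
    have Tval: "complex_of_real (chebyshev_T \<tau> (\<mu> j)) = c"
      if j: "j \<le> d" and eig: "\<And>x. A i *v (E j *v x) = c *s (E j *v x)" for j c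
    proof -
      obtain x where x: "E j *v x \<noteq> 0" using E_nonzero[OF j] by blast
      have "complex_of_real (chebyshev_T \<tau> (\<mu> j)) *s (E j *v x) = c *s (E j *v x)"
        using polyE[OF j, of "chebyshev_poly \<tau>" x] eig[of x] TA
        by (auto simp: poly_chebyshev_poly T_def)
      then show ?thesis using x by simp
    qed
    have "chebyshev_T \<tau> (\<mu> j) = 1" if "j \<in> plus_indices d E (A i)" for j
      using that Tval[of j 1] by (auto simp: plus_indices_def matrix_vector_mul_assoc)
    moreover have "chebyshev_T \<tau> (\<mu> j) = -1" if "j \<in> minus_indices d E (A i)" for j
    proof -
      have "A i *v (E j *v x) = (-1) *s (E j *v x)" for x
        using that by (simp only: minus_indices_def mem_Collect_eq matrix_vector_mul_assoc neg)
      then have "complex_of_real (chebyshev_T \<tau> (\<mu> j)) = -1"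
        using that Tval[of j "-1"] by (simp add: minus_indices_def)
      then have "complex_of_real (chebyshev_T \<tau> (\<mu> j)) = complex_of_real (-1)" by simp
      then show ?thesis by (simp only: of_real_eq_iff)
    qed
    ultimately show "\<exists>B \<in> A ` {..d}.
       fixed_point_free_involution_matrix B \<and> B $ u $ v = 1 \<and>
       (\<forall>j \<in> plus_indices d E B. chebyshev_T \<tau> (\<mu> j) = 1) \<and>
       (\<forall>j \<in> minus_indices d E B. chebyshev_T \<tau> (\<mu> j) = -1)"
      using i by blast
  next
    assume "\<exists>B \<in> A ` {..d}.
       fixed_point_free_involution_matrix B \<and> B $ u $ v = 1 \<and>
       (\<forall>j \<in> plus_indices d E B. chebyshev_T \<tau> (\<mu> j) = 1) \<and>
       (\<forall>j \<in> minus_indices d E B. chebyshev_T \<tau> (\<mu> j) = -1)"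
    then obtain B where B: "B \<in> A ` {..d}" "fixed_point_free_involution_matrix B" "B $ u $ v = 1"
      and plus: "\<And>j. j \<in> plus_indices d E B \<Longrightarrow> chebyshev_T \<tau> (\<mu> j) = 1"
      and minus: "\<And>j. j \<in> minus_indices d E B \<Longrightarrow> chebyshev_T \<tau> (\<mu> j) = -1"
      by blast
    have "B \<in> scheme_span d A"
      using B(1) by (simp add: scheme_span_eq_span matrix_space.span_base)
    then obtain q where q: "B = matpoly q P"
      by (rule scheme_span_matpoly[OF scheme P inj ev])
    \<comment> \<open>On the range of \<open>E j\<close>, \<open>B\<close> acts as the scalar
      \<open>q(\<mu> j)\<close>, which is 1 or -1 because \<open>B\<close> squares to the identity.
      So \<open>j\<close> is a plus or a minus index, and the matching condition gives the Chebyshev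
      polynomial the same value there.\<close>
    have "poly (chebyshev_poly \<tau> - q) (complex_of_real (\<mu> j)) = 0" if j: "j \<le> d" for j
    proof -
      let ?c = "poly q (complex_of_real (\<mu> j))"
      have BE: "B *v (E j *v x) = ?c *s (E j *v x)" for x
        unfolding q by (rule polyE[OF j])
      obtain x where x: "E j *v x \<noteq> 0" using E_nonzero[OF j] by blast
      have "(B ** B) *v (E j *v x) = (?c * ?c) *s (E j *v x)"
        by (simp only: matrix_vector_mul_assoc[symmetric] BE vector_scalar_commute
            vector_smult_assoc)
      then have "(?c * ?c) *s (E j *v x) = 1 *s (E j *v x)"
        by (simp add: fixed_point_free_involution_matrix_square[OF B(2)])
      then have "?c * ?c = 1" using x by (simp only: vec.scale_cancel_right) simp
      then consider "?c = 1" | "?c = -1"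
        by (metis power2_eq_1_iff power2_eq_square)
      then have "complex_of_real (chebyshev_T \<tau> (\<mu> j)) = ?c"
      proof cases
        case 1
        then have "(B ** E j) *v x = E j *v x" for x
          by (simp add: matrix_vector_mul_assoc[symmetric] BE)
        then have "B ** E j = E j" by (simp add: matrix_eq)
        then show ?thesis using plus[of j] j 1 by (simp add: plus_indices_def)
      next
        case 2
        have "(B ** E j) *v x = (- E j) *v x" for x
          by (simp only: matrix_vector_mul_assoc[symmetric] BE 2 neg)
        then have "B ** E j = - E j" by (simp add: matrix_eq)
        then show ?thesis using minus[of j] j 2 by (simp add: minus_indices_def)
      qed
      then show ?thesis by (simp add: poly_chebyshev_poly)
    qed
    then have "matpoly (chebyshev_poly \<tau> - q) P = 0"
      by (rule matpoly_eq_0_if_vanishes[OF scheme P inj ev])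
    then have "T = B" by (simp add: T_def q matpoly_diff)
    then have "T *v axis u 1 = 1 *s axis v 1"
      using fixed_point_free_involution_matrix_axis[OF B(2,3)] by simp
    then show "perfect_state_transfer adj u v \<tau>"
      unfolding pst by (intro exI[of _ 1]) simp
  qed
qed

end
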